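(* Let $E$ be a Fréchet space, with a given metric $d$ inducing its topology which is translation-invariant and satisfies $d(\lambda x, \lambda y) \le \lambda\, d(x,y)$ for all $x,y\in E$ and $\lambda\in[0,1]$. Let $I := \{(\lambda_1,\lambda_2,\lambda_3)\in[0,1]^3 \mid \lambda_1+\lambda_2+\lambda_3=1\}$ and define $\tilde W\colon E\times E\times[0,1]\to E$ and $\tilde K\colon E\times E\times E\times I\to E$ by $$\tilde W(x,y,t) := t x+(1-t) y,\qquad \tilde K(x,y,z,t_1,t_2,t_3) := t_1 x+t_2 y+t_3 z .$$ Then $\tilde W$ is a Takahashi convex structure on $(E,d)$, and $\tilde K$ is a Talman convex structure on $(E,d)$.
   Context: A Fréchet space is a complete and metrizable locally convex topological vector space. A metric $d$ on $E$ is translation-invariant if $d(x,y)=d(x+z,y+z)$ for all $x,y,z\in E$. A Takahashi convex structure on a metric space $(E,d)$ is a mapping $W\colon E\times E\times[0,1]\to E$ such that $d(u,W(x,y,t))\le t\,d(u,x)+(1-t)\,d(u,y)$ for all $u,x,y\in E$ and $t\in[0,1]$. With $I := \{(\lambda_1,\lambda_2,\lambda_3)\in[0,1]^3 \mid \lambda_1+\lambda_2+\lambda_3=1\}$, a Talman convex structure on $(E,d)$ is a mapping $K\colon E\times E\times E\times I\to E$ such that $d(u,K(x,y,z,t_1,t_2,t_3))\le t_1 d(u,x)+t_2 d(u,y)+t_3 d(u,z)$ for all $u,x,y,z\in E$ and $(t_1,t_2,t_3)\in I$. *)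

theory Defs
  imports "HOL-Analysis.Analysis"
begin

text \<open>Vector spaces are real and occupy a whole type; the topology is an explicit parameter,
  so that it need not be the canonical one of a type class.\<close>

definition topological_vector_space :: "'a::real_vector topology \<Rightarrow> bool" where
  "topological_vector_space T \<longleftrightarrow>
     topspace T = UNIV \<and>
     continuous_map (prod_topology T T) T (\<lambda>(x, y). x + y) \<and>
     continuous_map (prod_topology euclideanreal T) T (\<lambda>(c, x). c *\<^sub>R x)"

definition locally_convex_space :: "'a::real_vector topology \<Rightarrow> bool" where
  "locally_convex_space T \<longleftrightarrow> topological_vector_space T \<and> neighbourhood_base_of convex T"

text \<open>Completeness refers to the canonical uniformity of the vector space topology, whose
  entourages are generated by the sets of pairs with difference in a given neighbourhood of 0;
  it does not depend on the choice of a metric.\<close>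

definition tvs_cauchy_filter :: "'a::real_vector topology \<Rightarrow> 'a filter \<Rightarrow> bool" where
  "tvs_cauchy_filter T F \<longleftrightarrow>
     (\<forall>U. openin T U \<and> 0 \<in> U \<longrightarrow> (\<forall>\<^sub>F (x, y) in F \<times>\<^sub>F F. x - y \<in> U))"

definition tvs_complete :: "'a::real_vector topology \<Rightarrow> bool" where
  "tvs_complete T \<longleftrightarrow>
     (\<forall>F. F \<noteq> bot \<and> tvs_cauchy_filter T F \<longrightarrow> (\<exists>l. limitin T (\<lambda>x. x) l F))"

definition frechet_space :: "'a::real_vector topology \<Rightarrow> bool" where
  "frechet_space T \<longleftrightarrow> locally_convex_space T \<and> metrizable_space T \<and> tvs_complete T"

definition translation_invariant :: "('a::real_vector \<Rightarrow> 'a \<Rightarrow> real) \<Rightarrow> bool" where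
  "translation_invariant d \<longleftrightarrow> (\<forall>x y z. d x y = d (x + z) (y + z))"

definition takahashi_convex_structure ::
    "'a set \<Rightarrow> ('a \<Rightarrow> 'a \<Rightarrow> real) \<Rightarrow> ('a \<times> 'a \<times> real \<Rightarrow> 'a) \<Rightarrow> bool" where
  "takahashi_convex_structure M d W \<longleftrightarrow>
     Metric_space M d \<and>
     W \<in> M \<times> M \<times> {0..1} \<rightarrow> M \<and>
     (\<forall>u\<in>M. \<forall>x\<in>M. \<forall>y\<in>M. \<forall>t\<in>{0..1}.
        d u (W (x, y, t)) \<le> t * d u x + (1 - t) * d u y)"

definition talman_weights :: "(real \<times> real \<times> real) set" where
  "talman_weights =
     {(l1, l2, l3). l1 \<in> {0..1} \<and> l2 \<in> {0..1} \<and> l3 \<in> {0..1} \<and> l1 + l2 + l3 = 1}"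

definition talman_convex_structure ::
    "'a set \<Rightarrow> ('a \<Rightarrow> 'a \<Rightarrow> real) \<Rightarrow> ('a \<times> 'a \<times> 'a \<times> (real \<times> real \<times> real) \<Rightarrow> 'a) \<Rightarrow> bool" where
  "talman_convex_structure M d K \<longleftrightarrow>
     Metric_space M d \<and>
     K \<in> M \<times> M \<times> M \<times> talman_weights \<rightarrow> M \<and>
     (\<forall>u\<in>M. \<forall>x\<in>M. \<forall>y\<in>M. \<forall>z\<in>M. \<forall>(t1, t2, t3)\<in>talman_weights.
        d u (K (x, y, z, (t1, t2, t3))) \<le> t1 * d u x + t2 * d u y + t3 * d u z)"

definition W_tilde :: "'a::real_vector \<times> 'a \<times> real \<Rightarrow> 'a" where
  "W_tilde = (\<lambda>(x, y, t). t *\<^sub>R x + (1 - t) *\<^sub>R y)"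

definition K_tilde :: "'a::real_vector \<times> 'a \<times> 'a \<times> (real \<times> real \<times> real) \<Rightarrow> 'a" where
  "K_tilde = (\<lambda>(x, y, z, (t1, t2, t3)). t1 *\<^sub>R x + t2 *\<^sub>R y + t3 *\<^sub>R z)"

end

theory Submission
  imports Defs
begin

text \<open>Weights summing to 1 let any point \<open>u\<close> be written as the combination r u +
  s u + t u of copies of itself, to be compared with r x + s y + t z summand by summand. Translation
  invariance makes the distance between two sums at most the sum of the distances between
  corresponding summands (\<open>translation_invariant_dist_add_le\<close>), and the scaling
  hypothesis pulls each weight out of its distance. This gives the Talman inequality; the Takahashi
  inequality is its case of a vanishing third weight.\<close>

lemma translation_invariant_dist_add_le:
  assumes "Metric_space UNIV d" "translation_invariant d"
  shows "d (a + b) (a' + b') \<le> d a a' + d b b'"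
proof -
  interpret Metric_space UNIV d by fact
  have shift: "d (x + z) (y + z) = d x y" for x y z
    using assms(2) unfolding translation_invariant_def by metis
  \<comment> \<open>The intermediate point \<open>a' + b\<close> shares one summand with each
    endpoint, so each leg of the triangle inequality is a translate of \<open>d a a'\<close> or
    \<open>d b b'\<close>.\<close>
  have "d (a + b) (a' + b') \<le> d (a + b) (a' + b) + d (a' + b) (a' + b')"
    by (rule triangle) auto
  also have "d (a + b) (a' + b) = d a a'"
    by (rule shift)
  also have "d (a' + b) (a' + b') = d b b'"
    using shift[of b a' b'] by (simp add: add.commute)
  finally show ?thesis .
qed

theorem proposition5:
  fixes T :: "'a::real_vector topology"
    and d :: "'a \<Rightarrow> 'a \<Rightarrow> real"
  assumes "frechet_space T"
    and "Metric_space UNIV d"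
    and "Metric_space.mtopology UNIV d = T"
    and "translation_invariant d"
    and "\<And>x y c. c \<in> {0..1} \<Longrightarrow> d (c *\<^sub>R x) (c *\<^sub>R y) \<le> c * d x y"
  shows "takahashi_convex_structure UNIV d W_tilde \<and> talman_convex_structure UNIV d K_tilde"
proof -
  note add_le = translation_invariant_dist_add_le[OF assms(2,4)]
  have three: "d u (r *\<^sub>R x + s *\<^sub>R y + t *\<^sub>R z) \<le> r * d u x + s * d u y + t * d u z"
    if "(r, s, t) \<in> talman_weights" for u x y z r s t
  proof -
    have *: "r \<in> {0..1}" "s \<in> {0..1}" "t \<in> {0..1}" "r + s + t = 1"
      using that by (auto simp: talman_weights_def)
    \<comment> \<open>Splitting \<open>u\<close> with the same weights makes both arguments of
      \<open>d\<close> three-term sums, so that \<open>add_le\<close> applies twice.\<close>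
    have "r *\<^sub>R u + s *\<^sub>R u + t *\<^sub>R u = u"
      using *(4) by (simp flip: scaleR_left_distrib)
    then have "d u (r *\<^sub>R x + s *\<^sub>R y + t *\<^sub>R z)
        \<le> d (r *\<^sub>R u + s *\<^sub>R u) (r *\<^sub>R x + s *\<^sub>R y) + d (t *\<^sub>R u) (t *\<^sub>R z)"
      using add_le[of "r *\<^sub>R u + s *\<^sub>R u" "t *\<^sub>R u"] by simp
    also have "\<dots> \<le> d (r *\<^sub>R u) (r *\<^sub>R x) + d (s *\<^sub>R u) (s *\<^sub>R y) + d (t *\<^sub>R u) (t *\<^sub>R z)"
      by (intro add_right_mono add_le)
    also have "\<dots> \<le> r * d u x + s * d u y + t * d u z"
      by (intro add_mono assms(5) *)
    finally show ?thesis .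
  qed
  have two: "d u (t *\<^sub>R x + (1 - t) *\<^sub>R y) \<le> t * d u x + (1 - t) * d u y"
    if "t \<in> {0..1}" for u x y t
    \<comment> \<open>With third weight 0 the third point is arbitrary; \<open>y\<close> is a filler
      whose term vanishes on both sides.\<close>
    using three[of t "1 - t" 0 u x y y] that by (simp add: talman_weights_def)
  show ?thesis
    unfolding takahashi_convex_structure_def talman_convex_structure_def
    using assms(2) two three by (auto simp: W_tilde_def K_tilde_def)
qed

end
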